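(* Let $H$ be a Hilbert space, $T>0$, $x_0\in H$, let $A:D(A)\to H$ be the infinitesimal generator of a $C_0$-semigroup $\{e^{tA}\}_{t\ge0}$ of bounded linear operators on $H$, and let $B:H\to H$ be a bounded linear operator. Suppose that $\|e^{tA}\|\le Me^{\omega t}$ for all $t\ge 0$ with some constants $M\ge1$, $\omega\in\mathbb R$, and let $K\subset L^2(0,T)$ be a nonempty set of admissible controls such that $\|u(\cdot)\|_{L^2(0,T)}\le r$ for each $u(\cdot)\in K$. Let $\mathcal R_T(x_0)=\{x(T)\mid x(0)=x_0,\ u(\cdot)\in K\}\subset H$ be the reachable set at time $T$ of the control system $$\dot x(t)=(A+u(t)B)x(t),\quad t\in[0,T],\qquad x(0)=x_0 .$$ If $M\|B\|\sqrt T\,r<1$, then for each $n\in\mathbb N$, $n\ge1$, $$d_n(\mathcal R_T(x_0))_H\le M^2\|B\|\,\|x_0\|\sqrt T\,e^{\omega T}\,d_n(K)_{L^2(0,T)}+\frac{M^3\|B\|^2\|x_0\|\,T\,e^{\omega T}r^2}{1-M\|B\|\sqrt T\,r} .$$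
   Context: $L^2(0,T)$ is the real Lebesgue space of controls; $H$ may be real or complex. For $u\in L^2(0,T)$ the solution of $\dot x(t)=(A+u(t)B)x(t)$, $x(0)=x_0$, is the (mild) solution, represented by the Volterra series $$x(t)=e^{tA}x_0+\sum_{k=1}^\infty V_k(t;u),\qquad V_1(t;u)=\int_0^t w_1(t,\sigma_1)u(\sigma_1)\,d\sigma_1,$$ $$V_k(t;u)=\int_0^t\int_0^{\sigma_k}\cdots\int_0^{\sigma_2} w_k(t,\sigma_1,\dots,\sigma_k)\,u(\sigma_1)\cdots u(\sigma_k)\,d\sigma_1\cdots d\sigma_k\quad(k\ge 2),$$ with kernels $w_k(t,\sigma_1,\dots,\sigma_k)=e^{(t-\sigma_k)A}Be^{(\sigma_k-\sigma_{k-1})A}B\cdots Be^{\sigma_1A}x_0$ for $0\le\sigma_1\le\dots\le\sigma_k\le t$. For a Banach space $Z$, $\mathrm{Aff}_n(Z)$ denotes the set of all affine subspaces of $Z$ of dimension at most $n$ (over the scalar field of $Z$), i.e. sets $W=c+W_0$ with $c\in Z$ and $W_0$ a linear subspace of dimension at most $n$. For a nonempty set $S\subset Z$ and $n\ge1$, the affine Kolmogorov $n$-width is $$d_n(S)_Z=\inf_{W\in \mathrm{Aff}_n(Z)}\ \sup_{x\in S}\ \inf_{\xi\in W}\|x-\xi\|_Z .$$ *)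

theory Defs
  imports "HOL-Analysis.Analysis" "HOL-Library.Function_Algebras"
begin

text \<open>
  Hilbert spaces over \<open>\<real>\<close> or \<open>\<complex>\<close> are treated uniformly. By the Gelfand-Mazur theorem every type of
  class \<^class>\<open>real_normed_field\<close> is isomorphic to \<^typ>\<open>real\<close> or \<^typ>\<open>complex\<close>, so this class is
  used for the scalars. Conjugation is then determined by \<open>c * conj c = |c|^2\<close>.
\<close>

definition conj_scalar :: "'k::real_normed_field \<Rightarrow> 'k" where
  "conj_scalar c = of_real ((norm c)\<^sup>2) / c"

lemma conj_scalar_real: "conj_scalar (c::real) = c"
  by (simp add: conj_scalar_def power2_eq_square)

lemma conj_scalar_complex: "conj_scalar (c::complex) = cnj c"
  by (cases "c = 0") (simp_all add: conj_scalar_def complex_norm_square flip: of_real_power)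

text \<open>
  The real normed structure of the type is the one induced by the \<open>'k\<close>-Hilbert space structure;
  completeness is part of the class \<^class>\<open>banach\<close>. No separability is assumed.
\<close>

locale hilbert_space = vector_space scl
  for scl :: "'k::real_normed_field \<Rightarrow> 'h::banach \<Rightarrow> 'h" +
  fixes ip :: "'h \<Rightarrow> 'h \<Rightarrow> 'k"
  assumes scale_of_real: "scl (of_real a) x = a *\<^sub>R x"
    and ip_add_left: "ip (x + y) z = ip x z + ip y z"
    and ip_scale_left: "ip (scl c x) y = c * ip x y"
    and ip_commute: "ip x y = conj_scalar (ip y x)"
    and ip_self: "ip x x = of_real ((norm x)\<^sup>2)"

lemma hilbert_space_real:
  "hilbert_space scaleR (inner :: 'h::{real_inner,banach} \<Rightarrow> 'h \<Rightarrow> real)"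
  by unfold_locales
    (simp_all add: scaleR_add_right scaleR_add_left inner_add_left inner_add_right conj_scalar_real inner_commute
      power2_norm_eq_inner)

lemma hilbert_space_complex: "hilbert_space (*) (\<lambda>x y::complex. x * cnj y)"
  by unfold_locales
    (simp_all add: algebra_simps scaleR_conv_of_real conj_scalar_complex complex_norm_square del: of_real_power)

definition bounded_operator ::
    "('k::real_normed_field \<Rightarrow> 'h::banach \<Rightarrow> 'h) \<Rightarrow> ('h \<Rightarrow> 'h) \<Rightarrow> bool" where
  "bounded_operator scl f \<longleftrightarrow> Vector_Spaces.linear scl scl f \<and> bounded_linear f"

definition C0_semigroup ::
    "('k::real_normed_field \<Rightarrow> 'h::banach \<Rightarrow> 'h) \<Rightarrow> (real \<Rightarrow> 'h \<Rightarrow> 'h) \<Rightarrow> bool" where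
  "C0_semigroup scl S \<longleftrightarrow>
     (\<forall>t\<ge>0. bounded_operator scl (S t)) \<and>
     (\<forall>x. S 0 x = x) \<and>
     (\<forall>s\<ge>0. \<forall>t\<ge>0. \<forall>x. S (s + t) x = S s (S t x)) \<and>
     (\<forall>x. ((\<lambda>t. S t x) \<longlongrightarrow> x) (at_right 0))"

text \<open>The values of \<open>A\<close> outside its domain \<open>D\<close> are irrelevant.\<close>

definition infinitesimal_generator ::
    "(real \<Rightarrow> 'h::real_normed_vector \<Rightarrow> 'h) \<Rightarrow> 'h set \<Rightarrow> ('h \<Rightarrow> 'h) \<Rightarrow> bool" where
  "infinitesimal_generator S D A \<longleftrightarrow>
     (\<forall>x y. x \<in> D \<and> A x = y \<longleftrightarrow> ((\<lambda>h. (S h x - x) /\<^sub>R h) \<longlongrightarrow> y) (at_right 0))"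

text \<open>
  Elements of \<open>L\<^sup>2(0,T)\<close> are given by representatives; \<open>L2norm\<close> is the corresponding seminorm, and
  values outside \<open>(0,T)\<close> play no role.
\<close>

definition L2 :: "real \<Rightarrow> (real \<Rightarrow> real) set" where
  "L2 T = {u. u \<in> borel_measurable (lebesgue_on {0<..<T}) \<and>
              integrable (lebesgue_on {0<..<T}) (\<lambda>t. (u t)\<^sup>2)}"

definition L2norm :: "real \<Rightarrow> (real \<Rightarrow> real) \<Rightarrow> real" where
  "L2norm T u = sqrt (\<integral>t. (u t)\<^sup>2 \<partial>lebesgue_on {0<..<T})"

definition fun_scale :: "real \<Rightarrow> (real \<Rightarrow> real) \<Rightarrow> real \<Rightarrow> real" where
  "fun_scale a u = (\<lambda>t. a * u t)"

lemma vector_space_fun_scale: "vector_space fun_scale"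
  by unfold_locales (auto simp: fun_scale_def fun_eq_iff algebra_simps)

text \<open>
  Mild solutions: with \<open>S t = e^{tA}\<close>, the function \<open>x\<close> is continuous on \<open>[0,T]\<close> and satisfies
  \<open>x(t) = e^{tA} x0 + \<integral>\<^sub>0\<^sup>t e^{(t-s)A} u(s) B x(s) ds\<close> there. The integral is the Henstock-Kurzweil one
  because the library's Bochner integral is restricted to separable spaces; the integrand, an
  \<open>L\<^sup>1\<close> scalar function times a continuous one, is Bochner integrable, and the two integrals agree.
\<close>

definition mild_solution ::
    "(real \<Rightarrow> 'h::banach \<Rightarrow> 'h) \<Rightarrow> ('h \<Rightarrow> 'h) \<Rightarrow> real \<Rightarrow> 'h \<Rightarrow> (real \<Rightarrow> real) \<Rightarrow> (real \<Rightarrow> 'h) \<Rightarrow> bool"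
  where
  "mild_solution S B T x0 u x \<longleftrightarrow>
     continuous_on {0..T} x \<and>
     (\<forall>t\<in>{0..T}. ((\<lambda>s. S (t - s) (u s *\<^sub>R B (x s))) has_integral (x t - S t x0)) {0..t})"

definition reachable_set ::
    "(real \<Rightarrow> 'h::banach \<Rightarrow> 'h) \<Rightarrow> ('h \<Rightarrow> 'h) \<Rightarrow> (real \<Rightarrow> real) set \<Rightarrow> real \<Rightarrow> 'h \<Rightarrow> 'h set" where
  "reachable_set S B K T x0 = {x T | x u. u \<in> K \<and> mild_solution S B T x0 u x}"

text \<open>
  Affine subspaces of dimension at most \<open>n\<close> of the space with carrier \<open>Z\<close>. The dimension bound is
  expressed by a spanning set of at most \<open>n\<close> vectors since \<^term>\<open>vector_space.dim scl W0\<close> is \<open>0\<close>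
  for infinite-dimensional \<open>W0\<close>.
\<close>

definition Aff ::
    "('k::field \<Rightarrow> 'z::ab_group_add \<Rightarrow> 'z) \<Rightarrow> 'z set \<Rightarrow> nat \<Rightarrow> 'z set set" where
  "Aff scl Z n =
     {(+) c ` W0 | c W0. c \<in> Z \<and> W0 \<subseteq> Z \<and>
        (\<exists>F. finite F \<and> card F \<le> n \<and> W0 = module.span scl F)}"

text \<open>
  The width of \<open>X\<close> in the space with carrier \<open>Z\<close> and (semi)norm \<open>N\<close>. It is extended-real valued so
  that the suprema have their true value also when infinite.
\<close>

definition kolmogorov_width ::
    "('k::field \<Rightarrow> 'z::ab_group_add \<Rightarrow> 'z) \<Rightarrow> 'z set \<Rightarrow> ('z \<Rightarrow> real) \<Rightarrow> nat \<Rightarrow> 'z set \<Rightarrow> ereal" where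
  "kolmogorov_width scl Z N n X =
     (INF W\<in>Aff scl Z n. SUP x\<in>X. INF \<xi>\<in>W. ereal (N (x - \<xi>)))"

end

theory Submission imports Defs begin

text \<open>
  With \<open>q = M \<parallel>B\<parallel> \<surd>T r < 1\<close>, the integral equation gives
  \<open>\<parallel>x(t)\<parallel> \<le> M \<parallel>x0\<parallel> e^{\<omega>t} / (1 - q)\<close>, and inserting this bound into the equation twice shows that
  \<open>x(T)\<close> differs from \<open>S T x0 + V\<^sub>1(T;u)\<close> by at most \<open>q\<^sup>2 M \<parallel>x0\<parallel> e^{\<omega>T} / (1 - q)\<close>; no higher Volterra
  terms are needed. Since \<open>V\<^sub>1\<close> is linear and bounded on \<open>L\<^sup>2\<close>, the map \<open>u \<mapsto> S T x0 + V\<^sub>1(T;u)\<close> carries an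
  affine subspace approximating \<open>K\<close> into one of no larger dimension that approximates the reachable set.
\<close>

section \<open>Integrability of an absolutely integrable scalar function times a continuous vector
  function\<close>

text \<open>Replaces \<open>integrable_uniform_limit\<close> where the error is controlled only by an
  integrable function, as for \<open>u s *\<^sub>R g s\<close> with unbounded \<open>u\<close>.\<close>

lemma integrable_on_norm_approx:
  fixes f :: "'a::euclidean_space \<Rightarrow> 'b::banach"
  assumes approx: "\<And>e. e > 0 \<Longrightarrow> \<exists>g h. g integrable_on cbox a b \<and> h integrable_on cbox a b \<and>
      (\<forall>x\<in>cbox a b. norm (f x - g x) \<le> h x) \<and> integral (cbox a b) h \<le> e"
  shows "f integrable_on cbox a b"
  unfolding integrable_Cauchy
proof (intro allI impI)
  fix e :: real assume "e > 0"
  then obtain g h where g: "g integrable_on cbox a b" and h: "h integrable_on cbox a b"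
    and fgh: "\<And>x. x \<in> cbox a b \<Longrightarrow> norm (f x - g x) \<le> h x" and he: "integral (cbox a b) h \<le> e/5"
    using approx[of "e/5"] by auto
  define R where "R = (\<lambda>(f::'a \<Rightarrow> 'b) (\<D>::('a \<times> 'a set) set). \<Sum>(x,K)\<in>\<D>. measure lborel K *\<^sub>R f x)"
  obtain \<gamma>1 where \<gamma>1: "gauge \<gamma>1" and g1: "\<And>\<D>1 \<D>2. \<lbrakk>\<D>1 tagged_division_of cbox a b; \<gamma>1 fine \<D>1;
      \<D>2 tagged_division_of cbox a b; \<gamma>1 fine \<D>2\<rbrakk> \<Longrightarrow> norm (R g \<D>1 - R g \<D>2) < e/5"
    using g \<open>e > 0\<close> unfolding integrable_Cauchy R_def by (metis divide_pos_pos zero_less_numeral)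
  obtain \<gamma>2 where \<gamma>2: "gauge \<gamma>2" and h2: "\<And>\<D>. \<lbrakk>\<D> tagged_division_of cbox a b; \<gamma>2 fine \<D>\<rbrakk>
      \<Longrightarrow> norm ((\<Sum>(x,K)\<in>\<D>. measure lborel K *\<^sub>R h x) - integral (cbox a b) h) < e/5"
    using integrable_integral[OF h] \<open>e > 0\<close> unfolding has_integral by (metis divide_pos_pos zero_less_numeral)
  \<comment> \<open>One \<open>e/5\<close> bounds the integral of \<open>h\<close>, the other the
    gap between that integral and its Riemann sum. Two such errors and \<open>e/5\<close> for the
    sums of \<open>g\<close> add up to \<open>e\<close>.\<close>
  have near: "norm (R f \<D> - R g \<D>) \<le> 2*e/5"
    if \<D>: "\<D> tagged_division_of cbox a b" "\<gamma>2 fine \<D>" for \<D>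
  proof -
    have "R f \<D> - R g \<D> = (\<Sum>(x,K)\<in>\<D>. measure lborel K *\<^sub>R (f x - g x))"
      by (simp add: R_def sum_subtractf[symmetric] scaleR_diff_right case_prod_unfold)
    also have "norm \<dots> \<le> (\<Sum>(x,K)\<in>\<D>. measure lborel K *\<^sub>R h x)"
      using tagged_division_ofD(2,3)[OF \<D>(1)]
      by (intro sum_norm_le) (fastforce intro!: mult_left_mono fgh)
    also have "\<dots> \<le> 2*e/5"
      using h2[OF \<D>] he unfolding real_norm_def by linarith
    finally show ?thesis .
  qed
  show "\<exists>\<gamma>. gauge \<gamma> \<and> (\<forall>\<D>1 \<D>2. \<D>1 tagged_division_of cbox a b \<and> \<gamma> fine \<D>1 \<and>
            \<D>2 tagged_division_of cbox a b \<and> \<gamma> fine \<D>2 \<longrightarrow>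
            norm ((\<Sum>(x,K)\<in>\<D>1. measure lborel K *\<^sub>R f x) - (\<Sum>(x,K)\<in>\<D>2. measure lborel K *\<^sub>R f x)) < e)"
  proof (intro exI conjI allI impI; (elim conjE)?)
    show "gauge (\<lambda>x. \<gamma>1 x \<inter> \<gamma>2 x)"
      using \<gamma>1 \<gamma>2 by (rule gauge_Int)
    fix \<D>1 \<D>2 assume \<D>: "\<D>1 tagged_division_of cbox a b" "(\<lambda>x. \<gamma>1 x \<inter> \<gamma>2 x) fine \<D>1"
      "\<D>2 tagged_division_of cbox a b" "(\<lambda>x. \<gamma>1 x \<inter> \<gamma>2 x) fine \<D>2"
    have "norm (R f \<D>1 - R f \<D>2)
        = norm ((R f \<D>1 - R g \<D>1) + (R g \<D>1 - R g \<D>2) - (R f \<D>2 - R g \<D>2))"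
      by simp
    also have "\<dots> \<le> norm (R f \<D>1 - R g \<D>1) + norm (R g \<D>1 - R g \<D>2) + norm (R f \<D>2 - R g \<D>2)"
      by (intro order_trans[OF norm_triangle_ineq4] add_right_mono norm_triangle_ineq)
    also have "\<dots> < e"
      using near[of \<D>1] near[of \<D>2] g1[of \<D>1 \<D>2] \<D> by (simp add: fine_Int)
    finally show "norm ((\<Sum>(x,K)\<in>\<D>1. measure lborel K *\<^sub>R f x) - (\<Sum>(x,K)\<in>\<D>2. measure lborel K *\<^sub>R f x)) < e"
      by (simp add: R_def)
  qed
qed

text \<open>Freezing \<open>g\<close> at one sample point per cell of a fine grid leaves a finite
  sum of integrable real functions times fixed vectors. Uniform continuity of \<open>g\<close>
  bounds the error by a small multiple of \<open>\<bar>u\<bar>\<close>.\<close>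

lemma integrable_on_scaleR_continuous:
  fixes u :: "real \<Rightarrow> real" and g :: "real \<Rightarrow> 'b::banach"
  assumes u: "u absolutely_integrable_on {a..b}" and g: "continuous_on {a..b} g"
  shows "(\<lambda>s. u s *\<^sub>R g s) integrable_on {a..b}"
proof -
  have absu: "(\<lambda>s. \<bar>u s\<bar>) integrable_on {a..b}"
    using u by (simp add: absolutely_integrable_on_def)
  define I where "I = integral {a..b} (\<lambda>s. \<bar>u s\<bar>)"
  have "I \<ge> 0"
    unfolding I_def by (intro integral_nonneg absu) auto
  have "\<exists>G h. G integrable_on {a..b} \<and> h integrable_on {a..b} \<and>
      (\<forall>s\<in>{a..b}. norm (u s *\<^sub>R g s - G s) \<le> h s) \<and> integral {a..b} h \<le> e" if "e > 0" for e
  proof -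
    \<comment> \<open>The summand 1 keeps the quotient defined when \<open>I = 0\<close>.\<close>
    define \<epsilon> where "\<epsilon> = e / (I + 1)"
    have "\<epsilon> > 0"
      using that \<open>I \<ge> 0\<close> by (simp add: \<epsilon>_def)
    then obtain \<delta> where "\<delta> > 0" and \<delta>: "\<And>s t. \<lbrakk>s \<in> {a..b}; t \<in> {a..b}; dist s t < \<delta>\<rbrakk> \<Longrightarrow> dist (g s) (g t) < \<epsilon>"
      using compact_uniformly_continuous[OF g compact_Icc] unfolding uniformly_continuous_on_def by metis
    \<comment> \<open>The cells are half-open intervals of length \<open>\<delta>\<close>, and
      \<open>p k\<close> is a sample point. On a cell that misses \<open>{a..b}\<close> the choice
      is arbitrary; \<open>close\<close> speaks only of cells that contain a point of the
      interval.\<close>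
    define J where "J k = {s. \<lfloor>s / \<delta>\<rfloor> = k}" for k
    define p where "p k = (SOME s. s \<in> {a..b} \<inter> J k)" for k
    have J: "J k \<in> sets borel" for k
    proof -
      have "J k = {of_int k * \<delta> ..< (of_int k + 1) * \<delta>}"
        using \<open>\<delta> > 0\<close> by (auto simp: J_def floor_eq_iff field_simps)
      then show ?thesis by simp
    qed
    have close: "dist s (p k) < \<delta>" "p k \<in> {a..b}" if s: "s \<in> {a..b}" "\<lfloor>s / \<delta>\<rfloor> = k" for s k
    proof -
      have "p k \<in> {a..b} \<inter> J k"
        unfolding p_def by (rule someI[of _ s]) (use s in \<open>auto simp: J_def\<close>)
      then show "p k \<in> {a..b}" and "dist s (p k) < \<delta>"
        using s(2) \<open>\<delta> > 0\<close> by (auto simp: J_def floor_eq_iff dist_real_def field_simps)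
    qed
    define G where "G s = (\<Sum>k\<in>{\<lfloor>a/\<delta>\<rfloor>..\<lfloor>b/\<delta>\<rfloor>}. (indicat_real (J k) s * u s) *\<^sub>R g (p k))" for s
    have G_eq: "G s = u s *\<^sub>R g (p \<lfloor>s/\<delta>\<rfloor>)" if s: "s \<in> {a..b}" for s
    proof -
      have "\<lfloor>s/\<delta>\<rfloor> \<in> {\<lfloor>a/\<delta>\<rfloor>..\<lfloor>b/\<delta>\<rfloor>}"
        using s \<open>\<delta> > 0\<close> by (auto intro!: floor_mono divide_right_mono)
      moreover have "G s = (\<Sum>k\<in>{\<lfloor>a/\<delta>\<rfloor>..\<lfloor>b/\<delta>\<rfloor>}. if k = \<lfloor>s/\<delta>\<rfloor> then u s *\<^sub>R g (p k) else 0)"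
        unfolding G_def by (intro sum.cong) (auto simp: J_def)
      ultimately show ?thesis by simp
    qed
    have "G integrable_on {a..b}"
      unfolding G_def
    proof (intro integrable_sum integrable_on_scaleR_left set_lebesgue_integral_eq_integral(1)
        absolutely_integrable_bounded_measurable_product_real u)
      show "indicat_real (J k) \<in> borel_measurable (lebesgue_on {a..b})" for k
        using J[of k] by (intro measurable_restrict_space1 borel_measurable_indicator) auto
      show "bounded (indicat_real (J k) ` {a..b})" for k
        by (rule boundedI[of _ 1]) (auto simp: indicator_def)
    qed auto
    moreover have "(\<lambda>s. \<epsilon> * \<bar>u s\<bar>) integrable_on {a..b}"
      using absu by (rule integrable_on_mult_right)
    moreover have "norm (u s *\<^sub>R g s - G s) \<le> \<epsilon> * \<bar>u s\<bar>" if s: "s \<in> {a..b}" for s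
    proof -
      have "norm (u s *\<^sub>R g s - G s) = \<bar>u s\<bar> * dist (g s) (g (p \<lfloor>s/\<delta>\<rfloor>))"
        by (simp add: G_eq[OF s] dist_norm flip: scaleR_diff_right)
      also have "\<dots> \<le> \<bar>u s\<bar> * \<epsilon>"
        using \<delta>[OF s] close[OF s refl] by (intro mult_left_mono) (auto intro: less_imp_le)
      finally show ?thesis by (simp add: mult.commute)
    qed
    moreover have "integral {a..b} (\<lambda>s. \<epsilon> * \<bar>u s\<bar>) \<le> e"
      using \<open>I \<ge> 0\<close> that by (simp add: \<epsilon>_def I_def[symmetric] field_simps)
    ultimately show ?thesis by blast
  qed
  then show ?thesis
    using integrable_on_norm_approx[of a b "\<lambda>s. u s *\<^sub>R g s"] by (simp only: cbox_interval)
qed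

section \<open>The space of square-integrable controls\<close>

text \<open>On a bounded interval \<open>1 + (u t)\<^sup>2\<close> is an integrable majorant of
  \<open>\<bar>u t\<bar>\<close>; adding the two endpoints changes nothing.\<close>

lemma L2_absolutely_integrable:
  assumes "u \<in> L2 T"
  shows "u absolutely_integrable_on {0..T}"
proof -
  have u: "u \<in> borel_measurable (lebesgue_on {0<..<T})"
    and u2: "integrable (lebesgue_on {0<..<T}) (\<lambda>t. (u t)\<^sup>2)"
    using assms by (auto simp: L2_def)
  have "integrable (lebesgue_on {0<..<T}) (\<lambda>t. 1 + (u t)\<^sup>2)"
    using u2 by (intro Bochner_Integration.integrable_add)
      (auto simp: finite_measure.integrable_const finite_measure_lebesgue_on)
  then have "integrable (lebesgue_on {0<..<T}) u"
  proof (rule Bochner_Integration.integrable_bound)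
    have "\<bar>x\<bar> \<le> 1 + x\<^sup>2" for x :: real
      using zero_le_power2[of "\<bar>x\<bar> - 1/2"] by (simp add: power2_diff power_divide)
    then show "AE t in lebesgue_on {0<..<T}. norm (u t) \<le> norm (1 + (u t)\<^sup>2)"
      by (auto intro: order_trans)
  qed (fact u)
  then have "u absolutely_integrable_on box 0 T"
    by (simp add: set_integrable_def integrable_restrict_space)
  then show ?thesis
    using absolutely_integrable_on_open_interval[of 0 T u] by simp
qed

text \<open>This is where the powers of \<open>sqrt T\<close> in the final estimate come
  from.\<close>

lemma L2_integral_abs_le:
  assumes "u \<in> L2 T" "T > 0"
  shows "integral {0..T} (\<lambda>s. \<bar>u s\<bar>) \<le> sqrt T * L2norm T u"
proof -
  let ?M = "lebesgue_on {0<..<T}"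
  have u2: "integrable ?M (\<lambda>t. (u t)\<^sup>2)"
    using assms by (auto simp: L2_def)
  have "u absolutely_integrable_on {0<..<T}"
    using L2_absolutely_integrable[OF assms(1)] absolutely_integrable_on_open_interval[of 0 T u] by simp
  then have u: "integrable ?M (\<lambda>t. \<bar>u t\<bar>)"
    using absolutely_integrable_imp_integrable by fastforce
  define m where "m = (\<integral>t. \<bar>u t\<bar> \<partial>?M) / T"
  have eq: "integral {0..T} (\<lambda>s. \<bar>u s\<bar>) = m * T"
    using lebesgue_integral_eq_integral[OF u] integral_open_interval_real[of 0 T "\<lambda>s. \<bar>u s\<bar>"] assms(2)
    by (simp add: m_def)
  \<comment> \<open>Cauchy-Schwarz against the constant 1, as nonnegativity of the variance of \<open>\<bar>u\<bar>\<close>.\<close>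
  have "0 \<le> (\<integral>t. (\<bar>u t\<bar> - m)\<^sup>2 \<partial>?M)"
    by simp
  also have "\<dots> = (\<integral>t. (u t)\<^sup>2 - 2 * m * \<bar>u t\<bar> + m\<^sup>2 \<partial>?M)"
    by (simp add: power2_diff algebra_simps)
  also have "\<dots> = (\<integral>t. (u t)\<^sup>2 \<partial>?M) - 2 * m * (m * T) + m\<^sup>2 * T"
    using u u2 assms(2)
    by (simp add: m_def finite_measure.integrable_const finite_measure_lebesgue_on
        measure_restrict_space)
  finally have "m\<^sup>2 * T \<le> (\<integral>t. (u t)\<^sup>2 \<partial>?M)"
    by (simp add: power2_eq_square mult_ac)
  then have "sqrt T * sqrt (m\<^sup>2 * T) \<le> sqrt T * L2norm T u"
    using assms(2) by (simp add: L2norm_def del: real_sqrt_mult)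
  moreover have "sqrt T * sqrt (m\<^sup>2 * T) = \<bar>m\<bar> * T"
    using assms(2) by (simp add: real_sqrt_mult)
  ultimately show ?thesis
    using assms(2) by (simp add: eq) (smt (verit) mult_right_mono)
qed

lemma L2_subspace: "module.subspace fun_scale (L2 T)"
proof -
  interpret vector_space fun_scale by (rule vector_space_fun_scale)
  show ?thesis
  proof (rule subspaceI)
    show "0 \<in> L2 T" by (simp add: L2_def zero_fun_def)
    show "fun_scale c u \<in> L2 T" if "u \<in> L2 T" for c u
      using that by (auto simp: L2_def fun_scale_def power_mult_distrib)
    show "u + v \<in> L2 T" if "u \<in> L2 T" "v \<in> L2 T" for u v
    proof -
      let ?M = "lebesgue_on {0<..<T}"
      have m: "u \<in> borel_measurable ?M" "v \<in> borel_measurable ?M"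
        and i: "integrable ?M (\<lambda>t. (u t)\<^sup>2)" "integrable ?M (\<lambda>t. (v t)\<^sup>2)"
        using that by (auto simp: L2_def)
      have "integrable ?M (\<lambda>t. 2 * (u t)\<^sup>2 + 2 * (v t)\<^sup>2)"
        using i by simp
      then have "integrable ?M (\<lambda>t. (u t + v t)\<^sup>2)"
      proof (rule Bochner_Integration.integrable_bound)
        have "(x + y)\<^sup>2 \<le> 2 * x\<^sup>2 + 2 * y\<^sup>2" for x y :: real
          using zero_le_power2[of "x - y"] by (simp add: power2_diff power2_sum)
        then show "AE t in ?M. norm ((u t + v t)\<^sup>2) \<le> norm (2 * (u t)\<^sup>2 + 2 * (v t)\<^sup>2)"
          by (simp add: abs_of_nonneg)
      qed (use m in simp)
      then show ?thesis
        using m by (simp add: L2_def plus_fun_def)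
    qed
  qed
qed

section \<open>Infima of extended reals and images of affine subspaces\<close>

text \<open>For \<open>C > 0\<close> the inequality is solved for \<open>f i\<close>. For
  \<open>C = 0\<close> the product is 0 even if the infimum is infinite, and any single index gives
  the claim. It serves twice: for points of one affine subspace, then for all affine
  subspaces.\<close>

lemma ereal_le_cmult_INF_add:
  fixes a :: ereal and f :: "'i \<Rightarrow> ereal"
  assumes "C \<ge> 0" "I \<noteq> {}" and le: "\<And>i. i \<in> I \<Longrightarrow> a \<le> ereal C * f i + ereal R"
  shows "a \<le> ereal C * (INF i\<in>I. f i) + ereal R"
proof (cases "C = 0")
  case True
  then show ?thesis using assms by (auto simp flip: zero_ereal_def)
next
  case False
  then have C: "C > 0" using assms by simp
  have "(a - ereal R) / ereal C \<le> (INF i\<in>I. f i)"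
  proof (rule INF_greatest)
    fix i assume "i \<in> I"
    then have "a - ereal R \<le> ereal C * f i"
      using le by (simp add: ereal_minus_le)
    then show "(a - ereal R) / ereal C \<le> f i"
      using C by (simp add: ereal_divide_le_pos)
  qed
  then have "a - ereal R \<le> ereal C * (INF i\<in>I. f i)"
    using C by (simp add: ereal_divide_le_pos)
  then show ?thesis by (simp add: ereal_minus_le)
qed


text \<open>The map \<open>h\<close> of scalars allows \<open>f\<close> to go from a real space to a space over a larger field.\<close>

lemma Aff_additive_image:
  fixes f :: "'z::ab_group_add \<Rightarrow> 'w::ab_group_add"
  assumes "vector_space s1" "vector_space s2"
    and Z: "module.subspace s1 Z"
    and add: "\<And>x y. \<lbrakk>x \<in> Z; y \<in> Z\<rbrakk> \<Longrightarrow> f (x + y) = f x + f y"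
    and scale: "\<And>a x. x \<in> Z \<Longrightarrow> f (s1 a x) = s2 (h a) (f x)"
    and W: "W \<in> Aff s1 Z n"
  shows "\<exists>W'\<in>Aff s2 UNIV n. \<forall>x\<in>W. b + f x \<in> W'"
proof -
  interpret V1: vector_space s1 by fact
  interpret V2: vector_space s2 by fact
  obtain c F where c: "c \<in> Z" and F: "V1.span F \<subseteq> Z" "finite F" "card F \<le> n"
    and W_eq: "W = (+) c ` V1.span F"
    using W unfolding Aff_def by blast
  have f0: "f 0 = 0"
    using add[of 0 0] V1.subspace_0[OF Z] by simp
  \<comment> \<open>Membership in \<open>Z\<close> is carried through the induction because
    \<open>f\<close> is additive and homogeneous only there.\<close>
  have span: "w \<in> Z \<and> f w \<in> V2.span (f ` F)" if "w \<in> V1.span F" for w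
    using that
  proof (induction rule: V1.span_induct)
    case base
    show ?case
      by (rule V1.subspaceI)
        (simp_all add: f0 add scale V2.span_zero V2.span_add V2.span_scale
          V1.subspace_0[OF Z] V1.subspace_add[OF Z] V1.subspace_scale[OF Z])
  next
    case (step x)
    then show ?case
      using F(1) by (blast intro: V1.span_base V2.span_base)
  qed
  have "b + f x \<in> (+) (b + f c) ` V2.span (f ` F)" if x: "x \<in> W" for x
  proof -
    obtain w where "w \<in> V1.span F" "x = c + w"
      using x unfolding W_eq by blast
    then show ?thesis
      using span add[OF c] by (intro image_eqI[of _ _ "f w"]) (simp_all add: add.assoc)
  qed
  moreover have "(+) (b + f c) ` V2.span (f ` F) \<in> Aff s2 UNIV n"
    unfolding Aff_def using F(2,3) card_image_le[OF F(2), of f]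
    by (intro CollectI exI[of _ "b + f c"] exI[of _ "V2.span (f ` F)"] conjI exI[of _ "f ` F"]) auto
  ultimately show ?thesis by blast
qed

section \<open>Semigroup setting: the first Volterra term and strong continuity\<close>

text \<open>The term \<open>V_1(T;u)\<close>. The scalar \<open>u s\<close> stands inside
  \<open>S (T - s)\<close>, as in \<open>mild_solution\<close>, so that the two integrands can be
  subtracted directly.\<close>

definition volterra1 ::
    "(real \<Rightarrow> 'h::banach \<Rightarrow> 'h) \<Rightarrow> ('h \<Rightarrow> 'h) \<Rightarrow> real \<Rightarrow> 'h \<Rightarrow> (real \<Rightarrow> real) \<Rightarrow> 'h" where
  "volterra1 S B T x0 u = integral {0..T} (\<lambda>s. S (T - s) (u s *\<^sub>R B (S s x0)))"

locale exp_bounded_semigroup =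
  fixes S :: "real \<Rightarrow> 'h::banach \<Rightarrow> 'h" and M \<omega> :: real
  assumes bounded_linear: "t \<ge> 0 \<Longrightarrow> bounded_linear (S t)"
    and zero: "S 0 x = x"
    and semigroup: "\<lbrakk>s \<ge> 0; t \<ge> 0\<rbrakk> \<Longrightarrow> S (s + t) x = S s (S t x)"
    and right_continuous: "((\<lambda>t. S t x) \<longlongrightarrow> x) (at_right 0)"
    and M_pos: "M > 0"
    and norm_le: "t \<ge> 0 \<Longrightarrow> norm (S t x) \<le> M * exp (\<omega> * t) * norm x"
begin

lemma norm_le_uniform:
  assumes "0 \<le> t" "t \<le> T"
  shows "norm (S t x) \<le> M * exp (\<bar>\<omega>\<bar> * T) * norm x"
proof -
  have "\<omega> * t \<le> \<bar>\<omega>\<bar> * T"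
    using assms by (intro mult_mono) auto
  then have "M * exp (\<omega> * t) * norm x \<le> M * exp (\<bar>\<omega>\<bar> * T) * norm x"
    using M_pos by (intro mult_right_mono mult_left_mono) auto
  with norm_le[OF assms(1), of x] show ?thesis by linarith
qed

text \<open>Factoring out \<open>S (min s t)\<close> reduces both orders of \<open>s\<close> and
  \<open>t\<close> to the behaviour at 0. As \<open>min s t \<le> t\<close>, the constant depends on
  \<open>t\<close> alone, which yields continuity at \<open>t\<close> from both sides.\<close>

lemma norm_diff_le:
  assumes "0 \<le> s" "0 \<le> t"
  shows "norm (S s x - S t x) \<le> M * exp (\<bar>\<omega>\<bar> * t) * norm (S \<bar>s - t\<bar> x - x)"
proof -
  define a where "a = min s t"
  have "a \<ge> 0"
    using assms by (simp add: a_def)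
  interpret Sa: bounded_linear "S a"
    using \<open>a \<ge> 0\<close> by (rule bounded_linear)
  have "S a (S \<bar>s - t\<bar> x - x) = S (a + \<bar>s - t\<bar>) x - S a x"
    using \<open>a \<ge> 0\<close> by (simp add: Sa.diff semigroup)
  moreover have "norm (S (a + \<bar>s - t\<bar>) x - S a x) = norm (S s x - S t x)"
    by (auto simp: a_def min_def abs_real_def norm_minus_commute)
  ultimately show ?thesis
    using norm_le_uniform[of a t "S \<bar>s - t\<bar> x - x"] assms by (simp add: a_def)
qed

lemma continuous_on_orbit: "continuous_on {0..} (\<lambda>t. S t x)"
  unfolding continuous_on_iff
proof (intro ballI allI impI)
  fix t e :: real assume t: "t \<in> {0..}" and e: "e > 0"
  define C where "C = M * exp (\<bar>\<omega>\<bar> * t)"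
  have "C > 0" using M_pos by (simp add: C_def)
  then have "eventually (\<lambda>h. dist (S h x) x < e / C) (at_right 0)"
    using e by (intro tendstoD right_continuous) simp
  then obtain d where d: "d > 0" "\<And>h. \<lbrakk>0 < h; h < d\<rbrakk> \<Longrightarrow> dist (S h x) x < e / C"
    by (auto simp: eventually_at_right_field)
  have "dist (S s x) (S t x) < e" if s: "s \<in> {0..}" "dist s t < d" for s
  proof -
    \<comment> \<open>The choice of \<open>d\<close> covers only positive times; for
      \<open>s = t\<close> the difference vanishes since \<open>S 0\<close> is the identity.\<close>
    have "norm (S \<bar>s - t\<bar> x - x) < e / C"
      using d(2)[of "\<bar>s - t\<bar>"] s(2) e \<open>C > 0\<close>
      by (cases "s = t") (simp_all add: zero dist_norm)
    then have "C * norm (S \<bar>s - t\<bar> x - x) < e"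
      using \<open>C > 0\<close> by (simp add: field_simps)
    with norm_diff_le[of s t x] s(1) t show ?thesis
      by (simp add: C_def dist_norm)
  qed
  then show "\<exists>d>0. \<forall>s\<in>{0..}. dist s t < d \<longrightarrow> dist (S s x) (S t x) < e"
    using d(1) by blast
qed

text \<open>Near \<open>t\<close>, \<open>S (T - s) (v s)\<close> splits into an orbit of the fixed
  vector \<open>v t\<close> and \<open>S (T - s) (v s - v t)\<close>, which tends to 0 because the
  operators are uniformly bounded on \<open>{0..T}\<close>.\<close>

lemma continuous_on_convolution:
  assumes "continuous_on {0..T} v"
  shows "continuous_on {0..T} (\<lambda>s. S (T - s) (v s))"
  unfolding continuous_on_def
proof
  fix t assume t: "t \<in> {0..T}"
  have "continuous_on {0..T} (\<lambda>s. S (T - s) (v t))"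
    by (rule continuous_on_compose2[OF continuous_on_orbit]) (auto intro!: continuous_intros)
  then have 1: "((\<lambda>s. S (T - s) (v t)) \<longlongrightarrow> S (T - t) (v t)) (at t within {0..T})"
    using t by (simp add: continuous_on_def)
  have "((\<lambda>s. S (T - s) (v s - v t)) \<longlongrightarrow> 0) (at t within {0..T})"
  proof (rule Lim_null_comparison)
    show "eventually (\<lambda>s. norm (S (T - s) (v s - v t)) \<le> M * exp (\<bar>\<omega>\<bar> * T) * norm (v s - v t))
        (at t within {0..T})"
      unfolding eventually_at_filter by (auto intro!: always_eventually norm_le_uniform)
    have "((\<lambda>s. v s - v t) \<longlongrightarrow> 0) (at t within {0..T})"
      using assms t by (simp add: continuous_on_def LIM_zero)
    then show "((\<lambda>s. M * exp (\<bar>\<omega>\<bar> * T) * norm (v s - v t)) \<longlongrightarrow> 0) (at t within {0..T})"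
      by (intro tendsto_mult_right_zero tendsto_norm_zero)
  qed
  then have "((\<lambda>s. S (T - s) (v s - v t) + S (T - s) (v t)) \<longlongrightarrow> 0 + S (T - t) (v t)) (at t within {0..T})"
    using 1 by (rule tendsto_add)
  moreover have "S (T - s) (v s - v t) + S (T - s) (v t) = S (T - s) (v s)" if "s \<in> {0..T}" for s
    using that bounded_linear[of "T - s"] by (simp add: linear_diff bounded_linear.linear)
  ultimately show "((\<lambda>s. S (T - s) (v s)) \<longlongrightarrow> S (T - t) (v t)) (at t within {0..T})"
    by (subst tendsto_cong[where g = "\<lambda>s. S (T - s) (v s - v t) + S (T - s) (v t)"])
      (auto simp: eventually_at_filter intro!: always_eventually)
qed

section \<open>Estimates for Duhamel integrals\<close>

text \<open>The growth factors \<open>exp (\<omega> * (t - s))\<close> and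
  \<open>exp (\<omega> * s)\<close> multiply to \<open>exp (\<omega> * t)\<close>, so only the
  integral of \<open>\<bar>u\<bar>\<close> remains. Each use turns the constant \<open>Y\<close>
  into \<open>q * Y\<close> with \<open>q = M * onorm B * sqrt T * r\<close>; it is applied to the
  free orbit, to the solution and to their difference.\<close>

lemma duhamel_bound:
  assumes B: "bounded_linear B" and u: "u \<in> L2 T" "L2norm T u \<le> r" and T: "T > 0" and t: "t \<in> {0..T}"
    and Y: "Y \<ge> 0" "\<And>s. s \<in> {0..T} \<Longrightarrow> norm (v s) \<le> Y * exp (\<omega> * s)"
    and I: "((\<lambda>s. S (t - s) (u s *\<^sub>R B (v s))) has_integral I) {0..t}"
  shows "norm I \<le> M * onorm B * sqrt T * r * Y * exp (\<omega> * t)"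
proof -
  define C where "C = M * onorm B * Y * exp (\<omega> * t)"
  have C: "C \<ge> 0"
    using M_pos Y(1) onorm_pos_le[OF B] by (simp add: C_def)
  have absu: "(\<lambda>s. \<bar>u s\<bar>) integrable_on {0..T}"
    using L2_absolutely_integrable[OF u(1)] by (simp add: absolutely_integrable_on_def)
  then have absu_t: "(\<lambda>s. \<bar>u s\<bar>) integrable_on {0..t}"
    by (rule integrable_on_subinterval) (use t in auto)
  have le: "norm (S (t - s) (u s *\<^sub>R B (v s))) \<le> C * \<bar>u s\<bar>" if s: "s \<in> {0..t}" for s
  proof -
    have "onorm B * norm (v s) \<le> onorm B * (Y * exp (\<omega> * s))"
      using s t Y(2)[of s] onorm_pos_le[OF B] by (intro mult_left_mono) auto
    then have "norm (u s *\<^sub>R B (v s)) \<le> \<bar>u s\<bar> * (onorm B * (Y * exp (\<omega> * s)))"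
      using order_trans[OF onorm[OF B, of "v s"]] by (simp add: mult_left_mono)
    then have "M * exp (\<omega> * (t - s)) * norm (u s *\<^sub>R B (v s))
        \<le> M * exp (\<omega> * (t - s)) * (\<bar>u s\<bar> * (onorm B * (Y * exp (\<omega> * s))))"
      using M_pos by (intro mult_left_mono) auto
    also have "\<dots> = C * \<bar>u s\<bar>"
      by (simp add: C_def right_diff_distrib exp_diff)
    finally show ?thesis
      using norm_le[of "t - s" "u s *\<^sub>R B (v s)"] s by auto
  qed
  have "norm I = norm (integral {0..t} (\<lambda>s. S (t - s) (u s *\<^sub>R B (v s))))"
    using I by (simp add: integral_unique)
  also have "\<dots> \<le> integral {0..t} (\<lambda>s. C * \<bar>u s\<bar>)"
    using le I absu_t by (intro integral_norm_bound_integral) (auto simp: integrable_on_def intro: has_integral_mult_right)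
  \<comment> \<open>The integral is enlarged to all of \<open>{0..T}\<close> because the control
    bound is given there.\<close>
  also have "\<dots> \<le> C * integral {0..T} (\<lambda>s. \<bar>u s\<bar>)"
    using absu absu_t t C by (simp add: mult_left_mono integral_subset_le)
  also have "\<dots> \<le> C * (sqrt T * r)"
    using u(2) T C
    by (intro mult_left_mono order_trans[OF L2_integral_abs_le[OF u(1) T]]) auto
  finally show ?thesis
    by (simp add: C_def mult_ac)
qed

text \<open>This shows that \<open>volterra1\<close> is a genuine integral and not the default value
  0: pulling \<open>u s\<close> out by linearity leaves a continuous factor.\<close>

lemma volterra1_has_integral:
  assumes B: "bounded_linear B" and u: "u \<in> L2 T"
  shows "((\<lambda>s. S (T - s) (u s *\<^sub>R B (S s x0))) has_integral volterra1 S B T x0 u) {0..T}"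
proof -
  have "continuous_on {0..T} (\<lambda>s. S s x0)"
    using continuous_on_orbit by (rule continuous_on_subset) auto
  then have "continuous_on {0..T} (\<lambda>s. S (T - s) (B (S s x0)))"
    by (intro continuous_on_convolution bounded_linear.continuous_on[OF B])
  then have "(\<lambda>s. u s *\<^sub>R S (T - s) (B (S s x0))) integrable_on {0..T}"
    using integrable_on_scaleR_continuous[OF L2_absolutely_integrable[OF u]] by blast
  moreover have "u s *\<^sub>R S (T - s) (B (S s x0)) = S (T - s) (u s *\<^sub>R B (S s x0))" if "s \<in> {0..T}" for s
    using that bounded_linear[of "T - s"] by (simp add: linear_scale bounded_linear.linear)
  ultimately have "(\<lambda>s. S (T - s) (u s *\<^sub>R B (S s x0))) integrable_on {0..T}"
    by (rule integrable_eq)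
  then show ?thesis
    by (simp add: volterra1_def integrable_integral)
qed

lemma volterra1_add:
  assumes B: "bounded_linear B" and u: "u \<in> L2 T" and v: "v \<in> L2 T"
  shows "volterra1 S B T x0 (u + v) = volterra1 S B T x0 u + volterra1 S B T x0 v"
proof -
  have "((\<lambda>s. S (T - s) (u s *\<^sub>R B (S s x0)) + S (T - s) (v s *\<^sub>R B (S s x0)))
      has_integral volterra1 S B T x0 u + volterra1 S B T x0 v) {0..T}"
    by (intro has_integral_add volterra1_has_integral assms)
  moreover have "S (T - s) (u s *\<^sub>R B (S s x0)) + S (T - s) (v s *\<^sub>R B (S s x0))
      = S (T - s) ((u + v) s *\<^sub>R B (S s x0))" if "s \<in> {0..T}" for s
    using that bounded_linear[of "T - s"]
    by (simp add: linear_add bounded_linear.linear scaleR_add_left)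
  ultimately have "((\<lambda>s. S (T - s) ((u + v) s *\<^sub>R B (S s x0)))
      has_integral volterra1 S B T x0 u + volterra1 S B T x0 v) {0..T}"
    by (rule has_integral_eq[rotated])
  then show ?thesis
    unfolding volterra1_def by (rule integral_unique)
qed

lemma volterra1_scale:
  assumes B: "bounded_linear B" and u: "u \<in> L2 T"
  shows "volterra1 S B T x0 (fun_scale c u) = c *\<^sub>R volterra1 S B T x0 u"
proof -
  have "((\<lambda>s. c *\<^sub>R S (T - s) (u s *\<^sub>R B (S s x0))) has_integral c *\<^sub>R volterra1 S B T x0 u) {0..T}"
    by (intro has_integral_cmul volterra1_has_integral assms)
  moreover have "c *\<^sub>R S (T - s) (u s *\<^sub>R B (S s x0)) = S (T - s) (fun_scale c u s *\<^sub>R B (S s x0))"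
    if "s \<in> {0..T}" for s
    using that bounded_linear[of "T - s"]
    by (simp add: linear_scale bounded_linear.linear fun_scale_def)
  ultimately have "((\<lambda>s. S (T - s) (fun_scale c u s *\<^sub>R B (S s x0)))
      has_integral c *\<^sub>R volterra1 S B T x0 u) {0..T}"
    by (rule has_integral_eq[rotated])
  then show ?thesis
    unfolding volterra1_def by (rule integral_unique)
qed

text \<open>One factor \<open>M\<close> comes from the orbit of \<open>x0\<close>, the other from
  \<open>S (T - s)\<close>. Taking \<open>r\<close> to be \<open>L2norm T u\<close> itself makes the
  bound proportional to the norm of the control.\<close>

lemma volterra1_bound:
  assumes "bounded_linear B" "u \<in> L2 T" "T > 0"
  shows "norm (volterra1 S B T x0 u) \<le> M\<^sup>2 * onorm B * norm x0 * sqrt T * exp (\<omega> * T) * L2norm T u"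
proof -
  have "norm (volterra1 S B T x0 u)
      \<le> M * onorm B * sqrt T * L2norm T u * (M * norm x0) * exp (\<omega> * T)"
    using M_pos norm_le[of _ x0] assms
    by (intro duhamel_bound[where v = "\<lambda>s. S s x0", OF _ _ order_refl _ _ _ _ volterra1_has_integral])
      (auto simp: mult_ac)
  then show ?thesis
    by (simp add: power2_eq_square mult_ac)
qed

text \<open>Weighting by \<open>exp (-\<omega> t)\<close> makes the Duhamel map a contraction for the supremum norm, so the
  solution can be bounded by evaluating the integral equation at the maximum point.\<close>

lemma mild_solution_bound:
  assumes B: "bounded_linear B" and u: "u \<in> L2 T" "L2norm T u \<le> r" and T: "T > 0"
    and small: "M * onorm B * sqrt T * r < 1" and x: "mild_solution S B T x0 u x" and t: "t \<in> {0..T}"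
  shows "norm (x t) \<le> M * norm x0 / (1 - M * onorm B * sqrt T * r) * exp (\<omega> * t)"
proof -
  let ?q = "M * onorm B * sqrt T * r"
  have cont: "continuous_on {0..T} x"
    using x by (simp add: mild_solution_def)
  have "\<exists>m\<in>{0..T}. \<forall>s\<in>{0..T}. exp (- \<omega> * s) * norm (x s) \<le> exp (- \<omega> * m) * norm (x m)"
    using T cont by (intro continuous_attains_sup continuous_intros) auto
  then obtain m where m: "m \<in> {0..T}"
    and max: "\<And>s. s \<in> {0..T} \<Longrightarrow> exp (- \<omega> * s) * norm (x s) \<le> exp (- \<omega> * m) * norm (x m)"
    by blast
  define Y where "Y = exp (- \<omega> * m) * norm (x m)"
  have le: "norm (x s) \<le> Y * exp (\<omega> * s)" if "s \<in> {0..T}" for s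
    using max[OF that] by (simp add: Y_def exp_minus field_simps)
  have "norm (x m - S m x0) \<le> ?q * Y * exp (\<omega> * m)"
    using x m le by (intro duhamel_bound[OF B u T m, of Y x]) (auto simp: mild_solution_def Y_def)
  moreover have "norm (x m) = Y * exp (\<omega> * m)"
    by (simp add: Y_def exp_minus)
  moreover have "norm (S m x0) \<le> M * norm x0 * exp (\<omega> * m)"
    using norm_le[of m x0] m by (simp add: mult_ac)
  ultimately have "Y * exp (\<omega> * m) \<le> (M * norm x0 + ?q * Y) * exp (\<omega> * m)"
    using norm_triangle_sub[of "x m" "S m x0"] by (simp add: distrib_right)
  then have "Y \<le> M * norm x0 + ?q * Y"
    by simp
  then have "Y \<le> M * norm x0 / (1 - ?q)"
    using small by (simp add: pos_le_divide_eq algebra_simps)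
  then have "Y * exp (\<omega> * t) \<le> M * norm x0 / (1 - ?q) * exp (\<omega> * t)"
    by (intro mult_right_mono) auto
  with le[OF t] show ?thesis by linarith
qed

text \<open>Subtracting \<open>volterra1\<close> from the integral equation leaves the Duhamel
  integral of \<open>x s - S s x0\<close>, which is itself a Duhamel integral of \<open>x\<close>.
  Each of the two levels gains a factor \<open>q\<close>.\<close>

lemma volterra_remainder_bound:
  assumes B: "bounded_linear B" and u: "u \<in> L2 T" "L2norm T u \<le> r" and T: "T > 0"
    and small: "M * onorm B * sqrt T * r < 1" and x: "mild_solution S B T x0 u x"
  shows "norm (x T - (S T x0 + volterra1 S B T x0 u))
    \<le> M^3 * (onorm B)\<^sup>2 * norm x0 * T * exp (\<omega> * T) * r\<^sup>2 / (1 - M * onorm B * sqrt T * r)"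
proof -
  define q where "q = M * onorm B * sqrt T * r"
  define Y where "Y = M * norm x0 / (1 - q)"
  have "r \<ge> 0"
    using u(2) by (rule order_trans[rotated]) (simp add: L2norm_def)
  then have q: "q \<ge> 0" and Y: "Y \<ge> 0"
    using M_pos onorm_pos_le[OF B] T small by (simp_all add: q_def Y_def)
  have eq: "((\<lambda>s. S (t - s) (u s *\<^sub>R B (x s))) has_integral (x t - S t x0)) {0..t}" if "t \<in> {0..T}" for t
    using x that by (simp add: mild_solution_def)
  have le: "norm (x t - S t x0) \<le> (q * Y) * exp (\<omega> * t)" if t: "t \<in> {0..T}" for t
    unfolding q_def
    using mild_solution_bound[OF B u T small x] Y eq[OF t]
    by (intro duhamel_bound[OF B u T t]) (auto simp: Y_def q_def)
  have "((\<lambda>s. S (T - s) (u s *\<^sub>R B (x s)) - S (T - s) (u s *\<^sub>R B (S s x0)))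
      has_integral (x T - S T x0 - volterra1 S B T x0 u)) {0..T}"
    using T by (intro has_integral_diff eq volterra1_has_integral B u) auto
  moreover have "S (T - s) (u s *\<^sub>R B (x s)) - S (T - s) (u s *\<^sub>R B (S s x0))
      = S (T - s) (u s *\<^sub>R B (x s - S s x0))" if "s \<in> {0..T}" for s
    using that bounded_linear[of "T - s"] B
    by (simp add: linear_diff bounded_linear.linear scaleR_diff_right)
  ultimately have "((\<lambda>s. S (T - s) (u s *\<^sub>R B (x s - S s x0)))
      has_integral (x T - S T x0 - volterra1 S B T x0 u)) {0..T}"
    by (rule has_integral_eq[rotated])
  then have "norm (x T - S T x0 - volterra1 S B T x0 u) \<le> M * onorm B * sqrt T * r * (q * Y) * exp (\<omega> * T)"
    using le T q Y by (intro duhamel_bound[OF B u T]) auto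
  \<comment> \<open>Two factors \<open>M\<close> come from \<open>q * q\<close>, which also turns
    \<open>sqrt T\<close> into \<open>T\<close>; the third comes from \<open>Y\<close>.\<close>
  also have "\<dots> = M^3 * (onorm B)\<^sup>2 * norm x0 * T * exp (\<omega> * T) * r\<^sup>2 / (1 - q)"
    using T by (simp add: q_def Y_def power2_eq_square power3_eq_cube mult_ac)
  finally show ?thesis
    by (simp add: q_def diff_diff_eq)
qed

end

section \<open>The width of the reachable set\<close>

lemma C0_semigroup_exp_bounded:
  assumes S: "C0_semigroup scl S" and "M > 0"
    and bound: "\<And>t. t \<ge> 0 \<Longrightarrow> onorm (S t) \<le> M * exp (\<omega> * t)"
  shows "exp_bounded_semigroup S M \<omega>"
proof (rule exp_bounded_semigroup.intro)
  show lin: "bounded_linear (S t)" if "t \<ge> 0" for t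
    using S that unfolding C0_semigroup_def bounded_operator_def by blast
  show "norm (S t x) \<le> M * exp (\<omega> * t) * norm x" if "t \<ge> 0" for t x
    by (rule order_trans[OF onorm[OF lin[OF that]] mult_right_mono[OF bound[OF that]]]) simp
  show "S 0 x = x" "((\<lambda>t. S t x) \<longlongrightarrow> x) (at_right 0)" for x
    using S unfolding C0_semigroup_def by blast+
  show "S (s + t) x = S s (S t x)" if "s \<ge> 0" "t \<ge> 0" for s t x
    using S that unfolding C0_semigroup_def by blast
qed fact

theorem theorem4p1:
  fixes scl :: "'k::real_normed_field \<Rightarrow> 'h::banach \<Rightarrow> 'h"
    and ip :: "'h \<Rightarrow> 'h \<Rightarrow> 'k"
    and S :: "real \<Rightarrow> 'h \<Rightarrow> 'h" and D :: "'h set" and A B :: "'h \<Rightarrow> 'h"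
    and x0 :: 'h and T M \<omega> r :: real and K :: "(real \<Rightarrow> real) set" and n :: nat
  assumes "hilbert_space scl ip"
    and "T > 0"
    and "C0_semigroup scl S" and "infinitesimal_generator S D A"
    and "bounded_operator scl B"
    and "M \<ge> 1" and "\<And>t. t \<ge> 0 \<Longrightarrow> onorm (S t) \<le> M * exp (\<omega> * t)"
    and "K \<noteq> {}" and "K \<subseteq> L2 T" and "\<And>u. u \<in> K \<Longrightarrow> L2norm T u \<le> r"
    and "M * onorm B * sqrt T * r < 1"
    and "n \<ge> 1"
  shows "kolmogorov_width scl UNIV norm n (reachable_set S B K T x0)
     \<le> ereal (M^2 * onorm B * norm x0 * sqrt T * exp (\<omega> * T)) *
         kolmogorov_width fun_scale (L2 T) (L2norm T) n K
       + ereal (M^3 * (onorm B)^2 * norm x0 * T * exp (\<omega> * T) * r^2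
                / (1 - M * onorm B * sqrt T * r))"
proof -
  interpret hilbert_space scl ip by fact
  interpret U: vector_space fun_scale by (rule vector_space_fun_scale)
  have B: "bounded_linear B"
    using assms(5) by (simp add: bounded_operator_def)
  interpret exp_bounded_semigroup S M \<omega>
    using assms(3,6,7) by (intro C0_semigroup_exp_bounded) auto
  define C where "C = M^2 * onorm B * norm x0 * sqrt T * exp (\<omega> * T)"
  define R where "R = M^3 * (onorm B)^2 * norm x0 * T * exp (\<omega> * T) * r^2 / (1 - M * onorm B * sqrt T * r)"
  let ?V = "volterra1 S B T x0"
  have C: "C \<ge> 0"
    using assms(2) onorm_pos_le[OF B] by (simp add: C_def)
  \<comment> \<open>The zero subspace has dimension 0, so the infimum defining the width of
    \<open>K\<close> is over a nonempty family.\<close>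
  have "(+) 0 ` U.span {} \<in> Aff fun_scale (L2 T) n"
    using U.subspace_0[OF L2_subspace] unfolding Aff_def
    by (intro CollectI exI[of _ 0] exI[of _ "U.span {}"] conjI exI[of _ "{}"]) auto
  then have nonempty: "Aff fun_scale (L2 T) n \<noteq> {}" by blast
  have main: "kolmogorov_width scl UNIV norm n (reachable_set S B K T x0)
      \<le> ereal C * (SUP u\<in>K. INF \<xi>\<in>W. ereal (L2norm T (u - \<xi>))) + ereal R"
    if W: "W \<in> Aff fun_scale (L2 T) n" for W
  proof -
    \<comment> \<open>Real scalars act on the state space through \<open>of_real\<close>. The images
      of the real spanning vectors span over \<open>'k\<close> a space that contains the real image,
      with no more generators.\<close>
    have "\<exists>W'\<in>Aff scl UNIV n. \<forall>\<xi>\<in>W. S T x0 + ?V \<xi> \<in> W'"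
      using W
      by (intro Aff_additive_image[OF vector_space_fun_scale vector_space_axioms L2_subspace, where h = of_real])
        (simp_all add: volterra1_add[OF B] volterra1_scale[OF B] scale_of_real)
    then obtain W' where W': "W' \<in> Aff scl UNIV n" "\<And>\<xi>. \<xi> \<in> W \<Longrightarrow> S T x0 + ?V \<xi> \<in> W'"
      by blast
    have W_L2: "W \<subseteq> L2 T" "W \<noteq> {}"
      using W U.subspace_add[OF L2_subspace] U.span_zero unfolding Aff_def by blast+
    have "kolmogorov_width scl UNIV norm n (reachable_set S B K T x0)
        \<le> (SUP x\<in>reachable_set S B K T x0. INF \<xi>\<in>W'. ereal (norm (x - \<xi>)))"
      unfolding kolmogorov_width_def by (rule INF_lower) (fact W'(1))
    also have "\<dots> \<le> ereal C * (SUP u\<in>K. INF \<xi>\<in>W. ereal (L2norm T (u - \<xi>))) + ereal R"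
    proof (rule SUP_least)
      fix y assume "y \<in> reachable_set S B K T x0"
      then obtain u x where u: "u \<in> K" and x: "mild_solution S B T x0 u x" and y: "y = x T"
        by (auto simp: reachable_set_def)
      have uL2: "u \<in> L2 T" using u assms(9) by blast
      have "(INF \<xi>\<in>W'. ereal (norm (y - \<xi>))) \<le> ereal C * (INF \<xi>\<in>W. ereal (L2norm T (u - \<xi>))) + ereal R"
      proof (rule ereal_le_cmult_INF_add[OF C W_L2(2)])
        fix \<xi> assume \<xi>: "\<xi> \<in> W"
        \<comment> \<open>The point of \<open>W'\<close> that competes with \<open>y\<close> is the
          first-order approximation of the state for the control \<open>\<xi>\<close>. The error
          splits into the Volterra remainder of \<open>u\<close> and the linear term in
          \<open>u - \<xi>\<close>.\<close>
        have "norm (y - (S T x0 + ?V \<xi>)) = norm ((x T - (S T x0 + ?V u)) + (?V u - ?V \<xi>))"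
          by (simp add: y algebra_simps)
        also have "\<dots> \<le> R + norm (?V u - ?V \<xi>)"
          unfolding R_def
          by (intro order_trans[OF norm_triangle_ineq] add_right_mono
              volterra_remainder_bound[OF B uL2 assms(10)[OF u] assms(2,11) x])
        also have "?V u - ?V \<xi> = ?V (u - \<xi>)"
          using volterra1_add[OF B, of "u - \<xi>" T \<xi> x0] U.subspace_diff[OF L2_subspace uL2] \<xi> W_L2(1)
          by auto
        also have "norm (?V (u - \<xi>)) \<le> C * L2norm T (u - \<xi>)"
          unfolding C_def
          using volterra1_bound[OF B, of "u - \<xi>" T x0] U.subspace_diff[OF L2_subspace uL2] \<xi> W_L2(1) assms(2)
          by auto
        finally have "norm (y - (S T x0 + ?V \<xi>)) \<le> C * L2norm T (u - \<xi>) + R"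
          by simp
        then show "(INF \<xi>\<in>W'. ereal (norm (y - \<xi>))) \<le> ereal C * ereal (L2norm T (u - \<xi>)) + ereal R"
          using W'(2)[OF \<xi>] by (intro INF_lower2) auto
      qed
      also have "\<dots> \<le> ereal C * (SUP u\<in>K. INF \<xi>\<in>W. ereal (L2norm T (u - \<xi>))) + ereal R"
        using C u by (intro add_right_mono ereal_mult_left_mono SUP_upper) auto
      finally show "(INF \<xi>\<in>W'. ereal (norm (y - \<xi>)))
          \<le> ereal C * (SUP u\<in>K. INF \<xi>\<in>W. ereal (L2norm T (u - \<xi>))) + ereal R" .
    qed
    finally show ?thesis .
  qed
  show ?thesis
    \<comment> \<open>\<open>C\<close> and \<open>R\<close> do not depend on \<open>W\<close>, so
      the infimum over \<open>W\<close> can be taken last.\<close>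
    using ereal_le_cmult_INF_add[OF C nonempty main]
    unfolding C_def R_def kolmogorov_width_def[of fun_scale] .
qed

end
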